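(* Let $T$ be a finite nonempty set and let $X=(X_t)_{t\in T}$ be a centered (jointly) Gaussian process with $\mathbf{E}|X_s-X_t|^2>0$ for all $s\neq t$. Let $\sigma^2:=\max_{t\in T}\mathrm{Var}[X_t]$. Then for every $\beta>0$ the quenched equilibrium free energy $\phi(\beta)$ satisfies $$\phi(\beta)\le\sqrt{2\sigma^2\,\mathbf{E} D_{1/2}(\nu_\beta\|\nu_0)}.$$
   Context: For $\beta\ge 0$, the random Gibbs measure $\nu_\beta$ on $T$ is the probability measure with $\nu_\beta(t)=e^{\beta X_t}/Z(\beta)$, $t\in T$, where $Z(\beta)=\sum_{t\in T}e^{\beta X_t}$; in particular $\nu_0$ is the uniform distribution on $T$. The quenched equilibrium free energy is $\phi(\beta):=\frac1\beta\,\mathbf{E}\log\big(\frac{1}{|T|}\sum_{t\in T}e^{\beta X_t}\big)$ for $\beta>0$. For $\alpha\in(0,\infty)$, $\alpha\ne1$, the Rényi divergence of order $\alpha$ between probability measures $\mu,\nu$ on $T$ (with $\nu$ strictly positive) is $D_\alpha(\mu\|\nu):=\frac{1}{\alpha-1}\log\sum_{t\in T}\mu^\alpha(t)\nu^{1-\alpha}(t)$; thus $D_{1/2}(\mu\|\nu)=-2\log\sum_{t\in T}\mu(t)^{1/2}\nu(t)^{1/2}$. $\mathbf{E}$ is expectation with respect to $X$. *)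

theory Defs
  imports "HOL-Probability.Probability"
begin

text \<open>
  Constants count as (degenerate) Gaussian variables, so that every positive semidefinite
  covariance is admitted; \<^const>\<open>normal_density\<close> takes the standard deviation, not the variance.
\<close>

definition gaussian_rv :: "'w measure \<Rightarrow> ('w \<Rightarrow> real) \<Rightarrow> bool" where
  "gaussian_rv M Y \<longleftrightarrow>
     Y \<in> borel_measurable M \<and>
     (\<exists>m. (\<exists>s>0. distributed M lborel Y (normal_density m s)) \<or> (AE w in M. Y w = m))"

definition gaussian_process :: "'w measure \<Rightarrow> 'i set \<Rightarrow> ('i \<Rightarrow> 'w \<Rightarrow> real) \<Rightarrow> bool" where
  "gaussian_process M T X \<longleftrightarrow>
     (\<forall>F c. finite F \<and> F \<subseteq> T \<longrightarrow> gaussian_rv M (\<lambda>w. \<Sum>t\<in>F. c t * X t w))"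

definition centered_gaussian_process ::
    "'w measure \<Rightarrow> 'i set \<Rightarrow> ('i \<Rightarrow> 'w \<Rightarrow> real) \<Rightarrow> bool" where
  "centered_gaussian_process M T X \<longleftrightarrow>
     gaussian_process M T X \<and> (\<forall>t\<in>T. prob_space.expectation M (X t) = 0)"

definition partition_fun :: "'i set \<Rightarrow> real \<Rightarrow> ('i \<Rightarrow> real) \<Rightarrow> real" where
  "partition_fun T \<beta> x = (\<Sum>t\<in>T. exp (\<beta> * x t))"

text \<open>
  The Gibbs measure of a realization \<open>x\<close>; the random Gibbs measure is obtained at
  \<open>x = (\<lambda>t. X t \<omega>)\<close>. It is meaningful for finite nonempty \<open>T\<close>, see \<open>pmf_gibbs\<close>.
\<close>

definition gibbs :: "'i set \<Rightarrow> real \<Rightarrow> ('i \<Rightarrow> real) \<Rightarrow> 'i pmf" where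
  "gibbs T \<beta> x =
     embed_pmf (\<lambda>t. if t \<in> T then exp (\<beta> * x t) / partition_fun T \<beta> x else 0)"

definition renyi_divergence :: "'i set \<Rightarrow> real \<Rightarrow> 'i pmf \<Rightarrow> 'i pmf \<Rightarrow> real" where
  "renyi_divergence T \<alpha> \<mu> \<nu> =
     1 / (\<alpha> - 1) * ln (\<Sum>t\<in>T. pmf \<mu> t powr \<alpha> * pmf \<nu> t powr (1 - \<alpha>))"

definition free_energy :: "'w measure \<Rightarrow> 'i set \<Rightarrow> ('i \<Rightarrow> 'w \<Rightarrow> real) \<Rightarrow> real \<Rightarrow> real" where
  "free_energy M T X \<beta> =
     1 / \<beta> * prob_space.expectation M (\<lambda>w. ln (1 / real (card T) * (\<Sum>t\<in>T. exp (\<beta> * X t w))))"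

lemma partition_fun_pos:
  assumes "finite T" "T \<noteq> {}"
  shows "partition_fun T \<beta> x > 0"
  using assms unfolding partition_fun_def by (intro sum_pos) auto

lemma pmf_gibbs:
  assumes "finite T" "T \<noteq> {}"
  shows "pmf (gibbs T \<beta> x) t = (if t \<in> T then exp (\<beta> * x t) / partition_fun T \<beta> x else 0)"
proof -
  let ?f = "\<lambda>t. if t \<in> T then exp (\<beta> * x t) / partition_fun T \<beta> x else 0"
  have pos: "partition_fun T \<beta> x > 0"
    using assms by (rule partition_fun_pos)
  have nonneg: "?f t \<ge> 0" for t
    using pos by auto
  have "(\<integral>\<^sup>+t. ennreal (?f t) \<partial>count_space UNIV) = (\<Sum>t\<in>T. ennreal (?f t))"
    using assms(1) by (intro nn_integral_count_space') auto
  also have "\<dots> = ennreal (\<Sum>t\<in>T. ?f t)"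
    by (intro sum_ennreal nonneg)
  also have "(\<Sum>t\<in>T. ?f t) = 1"
    using pos by (simp add: partition_fun_def flip: sum_divide_distrib)
  finally show ?thesis
    unfolding gibbs_def by (subst pmf_embed_pmf) (use nonneg in blast, auto)
qed

lemma gibbs_0:
  assumes "finite T" "T \<noteq> {}"
  shows "gibbs T 0 x = pmf_of_set T"
  using assms by (intro pmf_eqI) (simp add: pmf_gibbs partition_fun_def)

lemma renyi_divergence_half:
  "renyi_divergence T (1/2) \<mu> \<nu> = - 2 * ln (\<Sum>t\<in>T. sqrt (pmf \<mu> t) * sqrt (pmf \<nu> t))"
  by (simp add: renyi_divergence_def powr_half_sqrt)

end

theory Submission
  imports Defs
begin

text \<open>
  Let \<open>F \<beta> = \<beta> \<phi>(\<beta>)\<close> be the expected log-partition function, normalised by \<open>|T|\<close>. A direct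
  computation gives \<open>E D\<^bsub>1/2\<^esub>(\<nu>\<^sub>\<beta> \<parallel> \<nu>\<^sub>0) = F \<beta> - 2 F (\<beta>/2)\<close>. The function \<open>F\<close> is convex, vanishes at
  \<open>0\<close>, and by Jensen's inequality satisfies \<open>F b \<le> \<sigma>\<^sup>2 b\<^sup>2 / 2\<close>. These three properties suffice:
  at the midpoint \<open>\<beta>/2\<close>, compare \<open>F\<close> with its chord from \<open>x = F \<beta> / (\<sigma>\<^sup>2 \<beta>)\<close> to \<open>\<beta>\<close>.
\<close>

section \<open>A deterministic inequality for convex functions below a parabola\<close>

lemma convex_quadratic_midpoint_bound:
  fixes F :: "real \<Rightarrow> real"
  assumes conv: "convex_on {0..\<beta>} F" and F0: "F 0 = 0"
    and quad: "\<And>b. 0 \<le> b \<Longrightarrow> b \<le> \<beta> \<Longrightarrow> F b \<le> s * b\<^sup>2 / 2"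
    and "\<beta> > 0" and "s \<ge> 0"
  shows "F \<beta> / \<beta> \<le> sqrt (2 * s * (F \<beta> - 2 * F (\<beta> / 2)))"
proof (cases "F \<beta> > 0")
  case False
  \<comment> \<open>\<open>sqrt\<close> takes negative values on negative arguments, so the radicand
    must be shown nonnegative even though the left-hand side is at most 0. Midpoint convexity
    together with \<open>F 0 = 0\<close> does this.\<close>
  have "F (\<beta> / 2) \<le> F \<beta> / 2"
    using convex_onD[OF conv, of "1/2" 0 \<beta>] \<open>\<beta> > 0\<close> F0 by simp
  then have "0 \<le> 2 * s * (F \<beta> - 2 * F (\<beta> / 2))"
    using \<open>s \<ge> 0\<close> by simp
  moreover have "F \<beta> / \<beta> \<le> 0"
    using False \<open>\<beta> > 0\<close> by (simp add: divide_nonpos_pos)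
  ultimately show ?thesis
    by (meson order_trans real_sqrt_ge_zero)
next
  case True
  define A where "A = F \<beta>"
  have A: "A > 0" "A \<le> s * \<beta>\<^sup>2 / 2"
    using True quad[of \<beta>] \<open>\<beta> > 0\<close> by (auto simp: A_def)
  have s: "s > 0"
    using A \<open>s \<ge> 0\<close> by (cases "s = 0") auto
  \<comment> \<open>For a chord starting at height \<open>s * x\<^sup>2 / 2\<close> above
    \<open>x\<close>, convexity gives \<open>A - 2 * F (\<beta> / 2) \<ge> (A * x - s * \<beta> *
    x\<^sup>2 / 2) / (\<beta> - x)\<close>. This \<open>x\<close> maximises the numerator. The
    quadratic bound at \<open>\<beta>\<close> ensures \<open>x \<le> \<beta> / 2\<close>, so the
    midpoint lies under the chord.\<close>
  define x where "x = A / (s * \<beta>)"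
  have x0: "x > 0"
    using A s \<open>\<beta> > 0\<close> by (simp add: x_def)
  have x2: "x \<le> \<beta> / 2"
    using A s \<open>\<beta> > 0\<close> by (simp add: x_def field_simps power2_eq_square)
  have sx: "s * x = A / \<beta>"
    using s \<open>\<beta> > 0\<close> by (simp add: x_def)
  have "F x \<le> s * x\<^sup>2 / 2"
    using quad x0 x2 \<open>\<beta> > 0\<close> by simp
  also have "\<dots> = (s * x) * x / 2"
    by (simp add: power2_eq_square)
  finally have Fx: "F x \<le> A * x / (2 * \<beta>)"
    by (simp add: sx mult.commute)
  have pos: "\<beta> - x > 0"
    using x2 \<open>\<beta> > 0\<close> by linarith
  have "convex_on {x..\<beta>} F"
    using conv by (rule convex_on_subset) (use x0 in auto)
  then have "F (\<beta> / 2) \<le> (F x - A) / (\<beta> - x) * (\<beta> / 2) + A"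
    using convex_onD_Icc''[of x \<beta> F "\<beta> / 2"] x2 \<open>\<beta> > 0\<close> by (simp add: A_def)
  also have "\<dots> \<le> (A * x / (2 * \<beta>) - A) / (\<beta> - x) * (\<beta> / 2) + A"
    using Fx pos \<open>\<beta> > 0\<close> by (intro add_right_mono mult_right_mono divide_right_mono) auto
  also have "\<dots> = (A - A * x / (2 * (\<beta> - x))) / 2"
    using pos \<open>\<beta> > 0\<close> by (simp add: field_simps)
  finally have "A * x / (2 * (\<beta> - x)) \<le> A - 2 * F (\<beta> / 2)"
    by simp
  \<comment> \<open>Enlarging the denominator to \<open>2 * \<beta>\<close> loses a little, but
    after multiplication by \<open>2 * s\<close> it leaves exactly the square of
    \<open>A / \<beta>\<close>.\<close>
  moreover have "A * x / (2 * \<beta>) \<le> A * x / (2 * (\<beta> - x))"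
    using A x0 pos by (intro divide_left_mono) auto
  ultimately have "2 * s * (A * x / (2 * \<beta>)) \<le> 2 * s * (A - 2 * F (\<beta> / 2))"
    using s by (intro mult_left_mono) auto
  moreover have "2 * s * (A * x / (2 * \<beta>)) = (A / \<beta>)\<^sup>2"
    using s \<open>\<beta> > 0\<close> by (simp add: x_def field_simps power2_eq_square)
  ultimately show ?thesis
    unfolding A_def by (intro real_le_rsqrt) simp
qed

section \<open>The logarithm of the averaged exponentials for a fixed realization\<close>

text \<open>Subtracting the values \<open>A\<close> and \<open>B\<close> at the two endpoints inside
  the exponents normalises both weighted sums to 1. Convexity of \<open>exp\<close>, applied
  termwise, then bounds the normalised sum at the intermediate point by 1; this takes the place of
  Hoelder's inequality.\<close>

lemma convex_on_ln_sum_exp: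
  fixes x :: "'i \<Rightarrow> real"
  assumes "finite T" "T \<noteq> {}" "c > 0"
  shows "convex_on UNIV (\<lambda>b. ln (c * (\<Sum>t\<in>T. exp (b * x t))))"
proof
  fix u a b :: real
  assume u: "u > 0" "u < 1"
  define A where "A = ln (c * (\<Sum>t\<in>T. exp (a * x t)))"
  define B where "B = ln (c * (\<Sum>t\<in>T. exp (b * x t)))"
  have pos: "c * (\<Sum>t\<in>T. exp (r * x t)) > 0" for r
    using assms by (intro mult_pos_pos sum_pos) auto
  have eA: "c * (\<Sum>t\<in>T. exp (a * x t - A)) = 1" and eB: "c * (\<Sum>t\<in>T. exp (b * x t - B)) = 1"
    using pos[of a] pos[of b] \<open>c > 0\<close>
    by (auto simp: A_def B_def exp_diff zero_less_mult_iff simp flip: sum_divide_distrib)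
  let ?w = "(1 - u) * a + u * b" and ?W = "(1 - u) * A + u * B"
  have "exp (?w * x t - ?W) \<le> (1 - u) * exp (a * x t - A) + u * exp (b * x t - B)" for t
    using convex_onD[OF exp_convex, of u "a * x t - A" "b * x t - B"] u
    by (simp add: algebra_simps)
  then have "c * (\<Sum>t\<in>T. exp (?w * x t - ?W)) \<le>
      c * (\<Sum>t\<in>T. (1 - u) * exp (a * x t - A) + u * exp (b * x t - B))"
    using \<open>c > 0\<close> by (intro mult_left_mono sum_mono) auto
  also have "\<dots> = (1 - u) * (c * (\<Sum>t\<in>T. exp (a * x t - A))) + u * (c * (\<Sum>t\<in>T. exp (b * x t - B)))"
    by (simp add: sum.distrib distrib_left mult.left_commute[of c] flip: sum_distrib_left)
  also have "\<dots> = 1"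
    unfolding eA eB by simp
  finally have "c * (\<Sum>t\<in>T. exp (?w * x t)) \<le> exp ?W"
    by (simp add: exp_diff flip: sum_divide_distrib)
  then have "ln (c * (\<Sum>t\<in>T. exp (?w * x t))) \<le> ?W"
    using pos[of ?w] ln_le_cancel_iff[of _ "exp ?W"] by simp
  then show "ln (c * (\<Sum>t\<in>T. exp (((1 - u) *\<^sub>R a + u *\<^sub>R b) * x t))) \<le>
      (1 - u) * ln (c * (\<Sum>t\<in>T. exp (a * x t))) + u * ln (c * (\<Sum>t\<in>T. exp (b * x t)))"
    by (simp add: A_def B_def)
qed simp

definition log_mean_exp :: "'i set \<Rightarrow> real \<Rightarrow> ('i \<Rightarrow> real) \<Rightarrow> real" where
  "log_mean_exp T b x = ln (1 / real (card T) * (\<Sum>t\<in>T. exp (b * x t)))"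

text \<open>A crude bound, linear in the \<open>x t\<close>, that later serves as an integrable
  majorant: each exponent lies between \<open>- ?S\<close> and \<open>?S\<close>, hence so does the
  logarithm of the mean.\<close>

lemma abs_log_mean_exp_le:
  assumes "finite T" "T \<noteq> {}"
  shows "\<bar>log_mean_exp T b x\<bar> \<le> (\<Sum>t\<in>T. \<bar>b\<bar> * \<bar>x t\<bar>)"
proof -
  let ?S = "\<Sum>t\<in>T. \<bar>b\<bar> * \<bar>x t\<bar>" and ?m = "1 / real (card T) * (\<Sum>t\<in>T. exp (b * x t))"
  have card: "real (card T) > 0"
    using assms by (simp add: card_gt_0_iff)
  have S: "\<bar>b * x t\<bar> \<le> ?S" if "t \<in> T" for t
    using member_le_sum[of t T "\<lambda>t. \<bar>b\<bar> * \<bar>x t\<bar>"] assms that by (simp add: abs_mult)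
  have "(\<Sum>t\<in>T. exp (b * x t)) \<le> (\<Sum>t\<in>T. exp ?S)"
    by (intro sum_mono) (use S in \<open>auto simp: abs_le_iff\<close>)
  then have "?m \<le> exp ?S"
    using card by (simp add: field_simps)
  moreover have "(\<Sum>t\<in>T. exp (- ?S)) \<le> (\<Sum>t\<in>T. exp (b * x t))"
    by (intro sum_mono) (use S in \<open>force simp: abs_le_iff\<close>)
  then have "exp (- ?S) \<le> ?m"
    using card by (simp add: field_simps)
  moreover have "?m > 0"
    using card assms by (intro mult_pos_pos sum_pos) auto
  ultimately have "ln ?m \<le> ?S" "- ?S \<le> ln ?m"
    using ln_le_cancel_iff[of ?m "exp ?S"] by (simp_all only: ln_ge_iff ln_exp exp_gt_zero)
  then show ?thesis
    unfolding log_mean_exp_def by linarith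
qed

text \<open>The square root of a Gibbs weight at \<open>\<beta>\<close> is, up to normalisation, a
  Gibbs weight at \<open>\<beta> / 2\<close>. The sum defining the divergence is therefore a
  quotient of partition functions, and the powers of \<open>card T\<close> match those in
  \<open>log_mean_exp\<close>.\<close>

lemma renyi_divergence_half_gibbs:
  assumes "finite T" "T \<noteq> {}"
  shows "renyi_divergence T (1/2) (gibbs T \<beta> x) (gibbs T 0 x) =
    log_mean_exp T \<beta> x - 2 * log_mean_exp T (\<beta> / 2) x"
proof -
  let ?n = "real (card T)" and ?Z = "\<lambda>b. partition_fun T b x"
  have n: "?n > 0"
    using assms by (simp add: card_gt_0_iff)
  have Z: "?Z b > 0" for b
    using assms by (rule partition_fun_pos)
  have L: "log_mean_exp T b x = ln (?Z b) - ln ?n" for b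
    using Z[of b] n by (simp add: log_mean_exp_def partition_fun_def[symmetric] ln_div)
  have "sqrt (exp (\<beta> * x t)) = exp (\<beta> / 2 * x t)" for t
    by (rule real_sqrt_unique) (simp_all flip: exp_double)
  then have "(\<Sum>t\<in>T. sqrt (pmf (gibbs T \<beta> x) t) * sqrt (pmf (gibbs T 0 x) t)) =
      ?Z (\<beta> / 2) / (sqrt (?Z \<beta>) * sqrt ?n)"
    using assms by (simp add: pmf_gibbs partition_fun_def real_sqrt_divide flip: sum_divide_distrib)
  moreover have "ln \<dots> = ln (?Z (\<beta> / 2)) - ln (?Z \<beta>) / 2 - ln ?n / 2"
    using Z[of \<beta>] Z[of "\<beta> / 2"] n by (auto simp: ln_div ln_mult ln_sqrt)
  ultimately show ?thesis
    unfolding renyi_divergence_half L by simp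
qed

section \<open>Exponential moments of Gaussian variables\<close>

text \<open>Completing the square: tilting a normal density by \<open>exp (b * y)\<close> shifts its
  mean by \<open>b * s\<^sup>2\<close> and produces the stated constant.\<close>

lemma has_bochner_integral_exp_normal_density:
  assumes "s > 0"
  shows "has_bochner_integral lborel (\<lambda>y. normal_density m s y * exp (b * y))
    (exp (b * m + b\<^sup>2 * s\<^sup>2 / 2))"
proof -
  have "normal_density m s y * exp (b * y) =
      exp (b * m + b\<^sup>2 * s\<^sup>2 / 2) * normal_density (m + b * s\<^sup>2) s y" for y
  proof -
    have "- (y - m)\<^sup>2 / (2 * s\<^sup>2) + b * y =
        (b * m + b\<^sup>2 * s\<^sup>2 / 2) + - (y - (m + b * s\<^sup>2))\<^sup>2 / (2 * s\<^sup>2)"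
      using assms by (simp add: field_simps) algebra
    then show ?thesis
      by (simp add: normal_density_def flip: exp_add)
  qed
  moreover have "has_bochner_integral lborel (normal_density (m + b * s\<^sup>2) s) 1"
    using assms by (simp add: has_bochner_integral_iff)
  ultimately show ?thesis
    using has_bochner_integral_mult_right[of "exp (b * m + b\<^sup>2 * s\<^sup>2 / 2)" lborel] by fastforce
qed

lemma (in prob_space) gaussian_rv_integrable:
  assumes "gaussian_rv M Y"
  shows "integrable M Y"
proof -
  from assms have [measurable]: "Y \<in> borel_measurable M"
    by (simp add: gaussian_rv_def)
  from assms consider m s where "s > 0" "distributed M lborel Y (normal_density m s)"
    | m where "AE w in M. Y w = m"
    unfolding gaussian_rv_def by blast
  then show ?thesis
  proof cases
    case 1
    show ?thesis
      by (rule distributed_integrable_var[OF 1(2) _ integrable_normal_moment_nz_1[OF 1(1)]]) simp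
  next
    case 2
    then show ?thesis
      using integrable_cong_AE[of Y M "\<lambda>_. m"] by simp
  qed
qed

text \<open>Stated through expectation and variance, the formula covers both kinds of Gaussian
  variable: an almost surely constant one has variance 0, which leaves
  \<open>exp (b * m)\<close>.\<close>

lemma (in prob_space) gaussian_rv_mgf:
  assumes "gaussian_rv M Y"
  shows "has_bochner_integral M (\<lambda>w. exp (b * Y w)) (exp (b * expectation Y + b\<^sup>2 * variance Y / 2))"
proof -
  from assms have [measurable]: "Y \<in> borel_measurable M"
    by (simp add: gaussian_rv_def)
  from assms consider m s where "s > 0" "distributed M lborel Y (normal_density m s)"
    | m where "AE w in M. Y w = m"
    unfolding gaussian_rv_def by blast
  then show ?thesis
  proof cases
    case 1
    have "integrable M (\<lambda>w. exp (b * Y w))"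
      using has_bochner_integral_exp_normal_density[OF 1(1), of m b]
        distributed_integrable[OF 1(2), of "\<lambda>y. exp (b * y)"]
      by (simp add: has_bochner_integral_iff)
    moreover have "expectation (\<lambda>w. exp (b * Y w)) = exp (b * m + b\<^sup>2 * s\<^sup>2 / 2)"
      using has_bochner_integral_exp_normal_density[OF 1(1), of m b]
        distributed_integral[OF 1(2), of "\<lambda>y. exp (b * y)"]
      by (simp add: has_bochner_integral_iff)
    ultimately show ?thesis
      using normal_distributed_expectation[OF 1] normal_distributed_variance[OF 1]
      by (simp add: has_bochner_integral_iff)
  next
    case 2
    have EY: "expectation Y = m"
      using 2 by (subst integral_cong_AE[of _ _ "\<lambda>_. m"]) (auto simp: prob_space)
    have "variance Y = 0"
      using 2 unfolding EY by (subst integral_cong_AE[of _ _ "\<lambda>_. 0"]) auto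
    moreover have "has_bochner_integral M (\<lambda>w. exp (b * Y w)) (exp (b * m))"
      using 2 by (subst has_bochner_integral_cong_AE[of _ _ "\<lambda>_. exp (b * m)"])
        (auto simp: has_bochner_integral_iff prob_space)
    ultimately show ?thesis
      by (simp add: EY)
  qed
qed

section \<open>The expected logarithm as a function of the inverse temperature\<close>

context prob_space
begin

context
  fixes T :: "'i set" and X :: "'i \<Rightarrow> 'a \<Rightarrow> real"
  assumes fin: "finite T" and ne: "T \<noteq> {}" and gp: "centered_gaussian_process M T X"
begin

lemma gaussian_marginal:
  assumes "t \<in> T"
  shows "gaussian_rv M (X t)" "expectation (X t) = 0"
proof -
  have "gaussian_rv M (\<lambda>w. \<Sum>s\<in>{t}. (\<lambda>_. 1) s * X s w)"
    using gp assms unfolding centered_gaussian_process_def gaussian_process_def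
    by (elim conjE allE[of _ "{t}"] allE[of _ "\<lambda>_. 1"]) simp
  then show "gaussian_rv M (X t)"
    by simp
  show "expectation (X t) = 0"
    using gp assms by (simp add: centered_gaussian_process_def)
qed

text \<open>Dominated by a finite combination of the integrable \<open>\<bar>X t\<bar>\<close>.
  Monotonicity and linearity of the expectation rely on this below.\<close>

lemma integrable_log_mean_exp: "integrable M (\<lambda>w. log_mean_exp T b (\<lambda>t. X t w))"
proof (rule Bochner_Integration.integrable_bound)
  show "integrable M (\<lambda>w. \<Sum>t\<in>T. \<bar>b\<bar> * \<bar>X t w\<bar>)"
    using gaussian_rv_integrable gaussian_marginal by auto
  have "X t \<in> borel_measurable M" if "t \<in> T" for t
    using gaussian_marginal(1)[OF that] by (simp add: gaussian_rv_def)
  then show "(\<lambda>w. log_mean_exp T b (\<lambda>t. X t w)) \<in> borel_measurable M"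
    unfolding log_mean_exp_def by measurable
  show "AE w in M. norm (log_mean_exp T b (\<lambda>t. X t w)) \<le> norm (\<Sum>t\<in>T. \<bar>b\<bar> * \<bar>X t w\<bar>)"
  proof (rule AE_I2)
    fix w
    show "norm (log_mean_exp T b (\<lambda>t. X t w)) \<le> norm (\<Sum>t\<in>T. \<bar>b\<bar> * \<bar>X t w\<bar>)"
      using abs_log_mean_exp_le[OF fin ne, of b "\<lambda>t. X t w"] by simp
  qed
qed

lemma convex_on_expectation_log_mean_exp:
  "convex_on UNIV (\<lambda>b. expectation (\<lambda>w. log_mean_exp T b (\<lambda>t. X t w)))"
proof
  fix u a b :: real
  assume u: "u > 0" "u < 1"
  have conv: "convex_on UNIV (\<lambda>b. log_mean_exp T b x)" for x
    unfolding log_mean_exp_def using fin ne by (intro convex_on_ln_sum_exp) (auto simp: card_gt_0_iff)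
  have "expectation (\<lambda>w. log_mean_exp T ((1 - u) *\<^sub>R a + u *\<^sub>R b) (\<lambda>t. X t w)) \<le>
      expectation (\<lambda>w. (1 - u) * log_mean_exp T a (\<lambda>t. X t w) + u * log_mean_exp T b (\<lambda>t. X t w))"
    using u by (intro integral_mono convex_onD[OF conv] Bochner_Integration.integrable_add
        integrable_mult_right integrable_log_mean_exp) auto
  then show "expectation (\<lambda>w. log_mean_exp T ((1 - u) *\<^sub>R a + u *\<^sub>R b) (\<lambda>t. X t w)) \<le>
      (1 - u) * expectation (\<lambda>w. log_mean_exp T a (\<lambda>t. X t w)) +
      u * expectation (\<lambda>w. log_mean_exp T b (\<lambda>t. X t w))"
    using integrable_log_mean_exp by simp
qed simp

text \<open>Each \<open>exp (b * X t w)\<close> has expectation at most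
  \<open>exp (v * b\<^sup>2 / 2)\<close> by the Gaussian moment formula, hence so does their mean;
  concavity of \<open>ln\<close> moves the expectation inside.\<close>

lemma expectation_log_mean_exp_le:
  assumes var: "\<And>t. t \<in> T \<Longrightarrow> variance (X t) \<le> v"
  shows "expectation (\<lambda>w. log_mean_exp T b (\<lambda>t. X t w)) \<le> v * b\<^sup>2 / 2"
proof -
  let ?m = "\<lambda>w. 1 / real (card T) * (\<Sum>t\<in>T. exp (b * X t w))" and ?c = "v * b\<^sup>2 / 2"
  have card: "real (card T) > 0"
    using fin ne by (simp add: card_gt_0_iff)
  have mgf: "has_bochner_integral M (\<lambda>w. exp (b * X t w)) (exp (b\<^sup>2 * variance (X t) / 2))"
    if "t \<in> T" for t
    using gaussian_rv_mgf[OF gaussian_marginal(1)[OF that], of b] gaussian_marginal(2)[OF that]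
    by simp
  then have int: "integrable M (\<lambda>w. exp (b * X t w))" if "t \<in> T" for t
    using that by (simp add: has_bochner_integral_iff)
  have "expectation ?m = 1 / real (card T) * (\<Sum>t\<in>T. exp (b\<^sup>2 * variance (X t) / 2))"
    using mgf int by (simp add: has_bochner_integral_iff)
  also have "\<dots> \<le> 1 / real (card T) * (\<Sum>t\<in>T. exp ?c)"
    using var card
    by (intro mult_left_mono sum_mono) (auto simp: mult.commute[of v] intro!: mult_left_mono)
  also have "\<dots> = exp ?c"
    using card by simp
  finally have Em: "expectation ?m \<le> exp ?c" .
  \<comment> \<open>Jensen's inequality, through the tangent of \<open>ln\<close> at \<open>exp (v b\<^sup>2 / 2)\<close>.\<close>
  have "log_mean_exp T b (\<lambda>t. X t w) \<le> ?m w / exp ?c - 1 + ?c" for w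
  proof -
    have m: "?m w > 0"
      using card fin ne by (intro mult_pos_pos sum_pos) auto
    then have "ln (?m w / exp ?c) \<le> ?m w / exp ?c - 1"
      by (intro ln_le_minus_one divide_pos_pos) simp_all
    then show ?thesis
      using ln_divide_pos[OF m exp_gt_zero, of ?c] unfolding log_mean_exp_def ln_exp by linarith
  qed
  then have "expectation (\<lambda>w. log_mean_exp T b (\<lambda>t. X t w)) \<le>
      expectation (\<lambda>w. ?m w / exp ?c - 1 + ?c)"
    using int by (intro integral_mono integrable_log_mean_exp) auto
  also have "\<dots> = expectation ?m / exp ?c - 1 + ?c"
    using int by (simp add: prob_space)
  also have "expectation ?m / exp ?c \<le> 1"
    using Em by (subst divide_le_eq_1_pos) simp_all
  finally show ?thesis
    by simp
qed

end

end

theorem theorem4: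
  fixes M :: "'w measure" and T :: "'i set" and X :: "'i \<Rightarrow> 'w \<Rightarrow> real" and \<beta> :: real
  assumes "prob_space M"
    and "finite T" and "T \<noteq> {}"
    and "centered_gaussian_process M T X"
    and "\<And>s t. s \<in> T \<Longrightarrow> t \<in> T \<Longrightarrow> s \<noteq> t \<Longrightarrow>
           prob_space.expectation M (\<lambda>w. \<bar>X s w - X t w\<bar>\<^sup>2) > 0"
    and "\<beta> > 0"
  shows "free_energy M T X \<beta> \<le>
           sqrt (2 * Max ((\<lambda>t. prob_space.variance M (X t)) ` T) *
             prob_space.expectation M (\<lambda>w.
               renyi_divergence T (1/2) (gibbs T \<beta> (\<lambda>t. X t w)) (gibbs T 0 (\<lambda>t. X t w))))"
proof -
  interpret prob_space M by fact
  note T = \<open>finite T\<close> \<open>T \<noteq> {}\<close> and process = assms(2-4)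
  let ?v = "Max ((\<lambda>t. variance (X t)) ` T)"
  define F where "F b = expectation (\<lambda>w. log_mean_exp T b (\<lambda>t. X t w))" for b
  have var: "variance (X t) \<le> ?v" if "t \<in> T" for t
    using T that by (intro Max_ge) auto
  \<comment> \<open>A single variance, being nonnegative, bounds the maximum \<open>?v\<close> from
    below by 0.\<close>
  obtain t where "t \<in> T"
    using T by blast
  then have "?v \<ge> 0"
    by (rule order_trans[OF variance_positive var])
  moreover have "convex_on {0..\<beta>} F"
    using convex_on_expectation_log_mean_exp[OF process] unfolding F_def
    by (rule convex_on_subset) auto
  moreover have "F 0 = 0"
    using T by (simp add: F_def log_mean_exp_def)
  moreover have "F b \<le> ?v * b\<^sup>2 / 2" for b
    unfolding F_def using var by (rule expectation_log_mean_exp_le[OF process])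
  ultimately have "F \<beta> / \<beta> \<le> sqrt (2 * ?v * (F \<beta> - 2 * F (\<beta> / 2)))"
    using \<open>\<beta> > 0\<close> by (intro convex_quadratic_midpoint_bound) auto
  moreover have "free_energy M T X \<beta> = F \<beta> / \<beta>"
    by (simp add: free_energy_def F_def log_mean_exp_def)
  moreover have "expectation (\<lambda>w. renyi_divergence T (1/2) (gibbs T \<beta> (\<lambda>t. X t w))
      (gibbs T 0 (\<lambda>t. X t w))) = F \<beta> - 2 * F (\<beta> / 2)"
    using integrable_log_mean_exp[OF process]
    by (simp add: renyi_divergence_half_gibbs[OF T] F_def)
  ultimately show ?thesis
    by simp
qed

end
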